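(* Let $G$ be a connected graph. (a) If $G$ is a tree, then there is no self-similar sequence emanating from $G$. (b) If $G$ is a unicyclic graph and $\{G_k:k\geq 1\}$ is a self-similar sequence emanating from $G$, then each $G_k$ is a unicyclic graph. (c) If $c(G)\geq 2$ and $\{G_k:k\geq 1\}$ is a self-similar sequence emanating from $G$, then $c(G_k)$ increases to infinity as $k\to\infty$.
   Context: All graphs are finite, undirected, without loops and multiple edges. $|G|$ is the number of vertices and $e_G$ the number of edges of $G$. The cyclomatic number of a connected graph $G$ is $c(G)=e_G-|G|+1$; $G$ is a tree when $c(G)=0$ and unicyclic when $c(G)=1$. Two vertices $u,v$ of $G$ are automorphically similar if $\varphi(u)=v$ for some automorphism $\varphi$ of $G$; the equivalence classes $\mathcal O_1,\ldots,\mathcal O_\ell$ are the orbits of $G$. Given an ordering $(\mathcal O_1,\ldots,\mathcal O_\ell)$ of the orbits, the orbit divisor matrix of $G$ is $S_G=[s_{i,j}]_{i,j=1}^{\ell}$, where $s_{i,j}$ is the number of vertices in $\mathcal O_j$ adjacent to a vertex $u\in\mathcal O_i$ (this does not depend on the choice of $u\in\mathcal O_i$). Two connected graphs $G$ and $H$, possibly of different order, are orbitally similar if they have the same number of orbits and $S_G=S_H$ for suitable orderings of the orbits of $G$ and of the orbits of $H$. A self-similar sequence emanating from a connected graph $G$ is a sequence $\{G_k:k\geq 1\}$ of connected graphs such that $|G_1|<|G_2|<|G_3|<\cdots$, the graphs $G_1,G_2,G_3,\ldots$ are pairwise orbitally similar, and $G_1$ is isomorphic to $G$. *)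

theory Defs
  imports "Graph_Theory.Graph_Theory" "Jordan_Normal_Form.Matrix"
begin

text \<open>
  Finite simple graphs are the \<open>pair_graph\<close>s of the Graph Theory library: finite, loopless,
  symmetric digraphs, in which an undirected edge \<open>uv\<close> is the pair of arcs \<open>(u,v)\<close>, \<open>(v,u)\<close>.
  The library's \<open>connected\<close> excludes the null graph.  The library's \<open>tree\<close> is not used: it counts
  \<open>u,v,u\<close> as a cycle, so that no symmetric digraph with an arc is a tree in that sense.
\<close>

definition connected_graph :: "'a pair_pre_digraph \<Rightarrow> bool" where
  "connected_graph G \<longleftrightarrow> pair_graph G \<and> Digraph_Component.connected (with_proj G)"

definition edges :: "'a pair_pre_digraph \<Rightarrow> 'a set set" where
  "edges G = (\<lambda>(u, v). {u, v}) ` parcs G"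

definition cyclomatic_number :: "'a pair_pre_digraph \<Rightarrow> int" where
  "cyclomatic_number G = int (card (edges G)) - int (card (pverts G)) + 1"

definition tree_graph :: "'a pair_pre_digraph \<Rightarrow> bool" where
  "tree_graph G \<longleftrightarrow> connected_graph G \<and> cyclomatic_number G = 0"

definition unicyclic :: "'a pair_pre_digraph \<Rightarrow> bool" where
  "unicyclic G \<longleftrightarrow> connected_graph G \<and> cyclomatic_number G = 1"

definition automorphism :: "'a pair_pre_digraph \<Rightarrow> ('a \<Rightarrow> 'a) \<Rightarrow> bool" where
  "automorphism G \<phi> \<longleftrightarrow>
    (\<exists>h. pre_digraph.digraph_isomorphism (with_proj G) h \<and> app_iso h (with_proj G) = with_proj G
       \<and> iso_verts h = \<phi>)"

lemma (in pair_wf_digraph) automorphism_iff: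
  "automorphism G \<phi> \<longleftrightarrow>
     bij_betw \<phi> (pverts G) (pverts G) \<and> map_prod \<phi> \<phi> ` parcs G = parcs G"
proof
  assume "automorphism G \<phi>"
  then obtain h where h: "pre_digraph.digraph_isomorphism (with_proj G) h"
      "app_iso h (with_proj G) = with_proj G" "iso_verts h = \<phi>"
    by (auto simp: automorphism_def)
  have inj: "inj_on \<phi> (pverts G)"
    using h(1,3) by (auto simp: pre_digraph.digraph_isomorphism_def)
  have "verts (app_iso h (with_proj G)) = pverts G" "arcs (app_iso h (with_proj G)) = parcs G"
    "tail (app_iso h (with_proj G)) = fst" "head (app_iso h (with_proj G)) = snd"
    unfolding h(2) by simp_all
  then have eqs: "\<phi> ` pverts G = pverts G" "iso_arcs h ` parcs G = parcs G"
      "iso_tail h = fst" "iso_head h = snd"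
    using h(3) by simp_all
  have "iso_arcs h a = map_prod \<phi> \<phi> a" if "a \<in> parcs G" for a
  proof -
    have "\<phi> (fst a) = fst (iso_arcs h a)" "\<phi> (snd a) = snd (iso_arcs h a)"
      using h(1,3) that eqs(3,4) by (simp_all add: pre_digraph.digraph_isomorphism_def)
    then show ?thesis by (simp add: prod_eq_iff)
  qed
  then have "iso_arcs h ` parcs G = map_prod \<phi> \<phi> ` parcs G" by (rule image_cong[OF refl])
  then have "map_prod \<phi> \<phi> ` parcs G = parcs G" using eqs(2) by (simp only:)
  with inj eqs(1) show "bij_betw \<phi> (pverts G) (pverts G) \<and> map_prod \<phi> \<phi> ` parcs G = parcs G"
    by (simp add: bij_betw_def)
next
  assume a: "bij_betw \<phi> (pverts G) (pverts G) \<and> map_prod \<phi> \<phi> ` parcs G = parcs G"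
  define h :: "('a, 'a \<times> 'a, 'a, 'a \<times> 'a) digraph_isomorphism" where
    "h = \<lparr> iso_verts = \<phi>, iso_arcs = map_prod \<phi> \<phi>, iso_head = snd, iso_tail = fst \<rparr>"
  have "inj_on \<phi> (pverts G)" using a by (simp add: bij_betw_def)
  then have "inj_on (map_prod \<phi> \<phi>) (parcs G)"
    by (intro inj_on_subset[OF map_prod_inj_on[of \<phi> "pverts G" \<phi> "pverts G"]])
       (auto dest: in_arcsD1 in_arcsD2)
  then have "pre_digraph.digraph_isomorphism (with_proj G) h"
    using \<open>inj_on \<phi> (pverts G)\<close> wf_digraph
    by (auto simp: pre_digraph.digraph_isomorphism_def h_def)
  moreover have "app_iso h (with_proj G) = with_proj G"
    using a by (simp add: app_iso_def h_def with_proj_def bij_betw_def)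
  moreover have "iso_verts h = \<phi>" by (simp add: h_def)
  ultimately show "automorphism G \<phi>" by (auto simp: automorphism_def)
qed

definition aut_similar :: "'a pair_pre_digraph \<Rightarrow> 'a rel" where
  "aut_similar G = {(u, v). u \<in> pverts G \<and> v \<in> pverts G \<and> (\<exists>\<phi>. automorphism G \<phi> \<and> \<phi> u = v)}"

definition orbits :: "'a pair_pre_digraph \<Rightarrow> 'a set set" where
  "orbits G = pverts G // aut_similar G"

lemma (in pair_wf_digraph) equiv_aut_similar: "equiv (pverts G) (aut_similar G)"
proof (rule equivI)
  show "aut_similar G \<subseteq> pverts G \<times> pverts G" by (auto simp: aut_similar_def)
  have "automorphism G id" by (simp add: automorphism_iff map_prod.id)
  then show "refl_on (pverts G) (aut_similar G)"
    by (auto simp: refl_on_def aut_similar_def intro!: exI[of _ id])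
  show "sym (aut_similar G)"
  proof (rule symI)
    fix u v assume "(u, v) \<in> aut_similar G"
    then obtain \<phi> where uv: "u \<in> pverts G" "v \<in> pverts G" "automorphism G \<phi>" "\<phi> u = v"
      by (auto simp: aut_similar_def)
    let ?\<psi> = "inv_into (pverts G) \<phi>"
    have b: "bij_betw \<phi> (pverts G) (pverts G)" and e: "map_prod \<phi> \<phi> ` parcs G = parcs G"
      using uv(3) by (auto simp: automorphism_iff)
    have inv: "?\<psi> (\<phi> x) = x" if "x \<in> pverts G" for x
      using b that by (simp add: bij_betw_def)
    have "map_prod ?\<psi> ?\<psi> ` map_prod \<phi> \<phi> ` parcs G = (\<lambda>a. a) ` parcs G"
      unfolding image_image
    proof (rule image_cong[OF refl])
      fix a assume "a \<in> parcs G"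
      then have "fst a \<in> pverts G" "snd a \<in> pverts G"
        by (rule arc_fst_in_verts, rule arc_snd_in_verts)
      then show "map_prod ?\<psi> ?\<psi> (map_prod \<phi> \<phi> a) = a" by (simp add: prod_eq_iff inv)
    qed
    then have "automorphism G ?\<psi>"
      using b e by (simp add: automorphism_iff bij_betw_inv_into)
    moreover have "?\<psi> v = u" using inv uv by auto
    ultimately show "(v, u) \<in> aut_similar G" using uv by (auto simp: aut_similar_def)
  qed
  show "trans (aut_similar G)"
  proof (rule transI)
    fix u v w assume "(u, v) \<in> aut_similar G" "(v, w) \<in> aut_similar G"
    then obtain \<phi> \<psi> where uvw: "u \<in> pverts G" "w \<in> pverts G"
        "automorphism G \<phi>" "\<phi> u = v" "automorphism G \<psi>" "\<psi> v = w"
      by (auto simp: aut_similar_def)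
    have "map_prod (\<psi> \<circ> \<phi>) (\<psi> \<circ> \<phi>) ` parcs G = map_prod \<psi> \<psi> ` map_prod \<phi> \<phi> ` parcs G"
      by (simp add: image_image map_prod_def split_def)
    with uvw(3,5) have "automorphism G (\<psi> \<circ> \<phi>)"
      by (auto simp: automorphism_iff intro: bij_betw_trans)
    moreover have "(\<psi> \<circ> \<phi>) u = w" using uvw by simp
    ultimately show "(u, w) \<in> aut_similar G" using uvw by (auto simp: aut_similar_def)
  qed
qed

definition orbit_ordering :: "'a pair_pre_digraph \<Rightarrow> 'a set list \<Rightarrow> bool" where
  "orbit_ordering G Os \<longleftrightarrow> distinct Os \<and> set Os = orbits G"

definition nbrs_in :: "'a pair_pre_digraph \<Rightarrow> 'a \<Rightarrow> 'a set \<Rightarrow> nat" where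
  "nbrs_in G u X = card {v \<in> X. (u, v) \<in> parcs G}"

definition orbit_divisor_matrix :: "'a pair_pre_digraph \<Rightarrow> 'a set list \<Rightarrow> nat mat" where
  "orbit_divisor_matrix G Os =
    mat (length Os) (length Os) (\<lambda>(i, j). nbrs_in G (SOME u. u \<in> Os ! i) (Os ! j))"

text \<open>The entries do not depend on the representatives chosen.\<close>

lemma (in pair_wf_digraph) nbrs_in_orbit_cong:
  assumes "P \<in> orbits G" "Q \<in> orbits G" "u \<in> P" "u' \<in> P"
  shows "nbrs_in G u Q = nbrs_in G u' Q"
proof -
  note eq = equiv_aut_similar
  have "(u, u') \<in> aut_similar G"
    using assms quotient_eq_iff[OF eq, of P P u u'] by (auto simp: orbits_def)
  then obtain \<phi> where u: "u \<in> pverts G" "u' \<in> pverts G" "automorphism G \<phi>" "\<phi> u = u'"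
    by (auto simp: aut_similar_def)
  have b: "bij_betw \<phi> (pverts G) (pverts G)" and e: "map_prod \<phi> \<phi> ` parcs G = parcs G"
    using u(3) by (auto simp: automorphism_iff)
  have QV: "Q \<subseteq> pverts G"
    using assms(2) in_quotient_imp_subset[OF eq] by (auto simp: orbits_def)
  have Qiff: "\<phi> v \<in> Q \<longleftrightarrow> v \<in> Q" if "v \<in> pverts G" for v
  proof -
    have "\<phi> v \<in> pverts G" using b that by (auto simp: bij_betw_def)
    then have "(v, \<phi> v) \<in> aut_similar G" using that u(3) by (auto simp: aut_similar_def)
    then show ?thesis
      using assms(2) in_quotient_imp_closed[OF eq, of Q] eq
      unfolding orbits_def by (meson equiv_def symE)
  qed
  have arc: "(\<phi> x, \<phi> y) \<in> parcs G \<longleftrightarrow> (x, y) \<in> parcs G" if "x \<in> pverts G" "y \<in> pverts G" for x y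
  proof
    assume "(\<phi> x, \<phi> y) \<in> parcs G"
    then have "(\<phi> x, \<phi> y) \<in> map_prod \<phi> \<phi> ` parcs G" by (simp only: e)
    then obtain x' y' where xy: "(x', y') \<in> parcs G" "\<phi> x' = \<phi> x" "\<phi> y' = \<phi> y" by auto
    have "x' = x" "y' = y"
      using bij_betw_imp_inj_on[OF b] xy that in_arcsD1[OF xy(1)] in_arcsD2[OF xy(1)]
      by (simp_all add: inj_on_eq_iff)
    with xy show "(x, y) \<in> parcs G" by simp
  next
    assume "(x, y) \<in> parcs G"
    then have "map_prod \<phi> \<phi> (x, y) \<in> map_prod \<phi> \<phi> ` parcs G" by (rule imageI)
    then show "(\<phi> x, \<phi> y) \<in> parcs G" by (simp only: e map_prod_simp)
  qed
  have "{v \<in> Q. (u', v) \<in> parcs G} = \<phi> ` {v \<in> Q. (u, v) \<in> parcs G}"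
  proof (intro equalityI subsetI)
    fix w assume w: "w \<in> {v \<in> Q. (u', v) \<in> parcs G}"
    then obtain v where v: "v \<in> pverts G" "w = \<phi> v" using QV b by (auto simp: bij_betw_def)
    have "v \<in> Q" using w v Qiff by simp
    moreover have "(u, v) \<in> parcs G" using w v u(1,4) arc by blast
    ultimately show "w \<in> \<phi> ` {v \<in> Q. (u, v) \<in> parcs G}" using v(2) by simp
  next
    fix w assume "w \<in> \<phi> ` {v \<in> Q. (u, v) \<in> parcs G}"
    then obtain v where v: "w = \<phi> v" "v \<in> Q" "(u, v) \<in> parcs G" by blast
    then have "v \<in> pverts G" using QV by blast
    with v Qiff have "w \<in> Q" by simp
    moreover have "(u', w) \<in> parcs G" using arc[OF u(1) \<open>v \<in> pverts G\<close>] v u(4) by simp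
    ultimately show "w \<in> {v \<in> Q. (u', v) \<in> parcs G}" by simp
  qed
  moreover have "inj_on \<phi> {v \<in> Q. (u, v) \<in> parcs G}"
    using b QV by (auto simp: bij_betw_def intro: inj_on_subset)
  ultimately show ?thesis by (simp add: nbrs_in_def card_image)
qed

lemma (in pair_wf_digraph) orbit_divisor_matrix_entry:
  assumes "orbit_ordering G Os" "i < length Os" "j < length Os" "u \<in> Os ! i"
  shows "orbit_divisor_matrix G Os $$ (i, j) = card {v \<in> Os ! j. (u, v) \<in> parcs G}"
proof -
  have "Os ! i \<in> orbits G" "Os ! j \<in> orbits G"
    using assms by (auto simp: orbit_ordering_def)
  moreover have "(SOME u. u \<in> Os ! i) \<in> Os ! i" using assms(4) by (rule someI)
  ultimately show ?thesis
    using assms nbrs_in_orbit_cong[of "Os ! i" "Os ! j" "SOME u. u \<in> Os ! i" u]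
    by (simp add: orbit_divisor_matrix_def nbrs_in_def)
qed

definition orbitally_similar :: "'a pair_pre_digraph \<Rightarrow> 'b pair_pre_digraph \<Rightarrow> bool" where
  "orbitally_similar G H \<longleftrightarrow>
    connected_graph G \<and> connected_graph H \<and> card (orbits G) = card (orbits H) \<and>
    (\<exists>Os Ps. orbit_ordering G Os \<and> orbit_ordering H Ps \<and>
       orbit_divisor_matrix G Os = orbit_divisor_matrix H Ps)"

text \<open>Sequences are indexed from 1; the value at 0 is irrelevant.\<close>

definition self_similar_sequence ::
    "'a pair_pre_digraph \<Rightarrow> (nat \<Rightarrow> 'b pair_pre_digraph) \<Rightarrow> bool" where
  "self_similar_sequence G Gs \<longleftrightarrow>
    (\<forall>k\<ge>1. connected_graph (Gs k)) \<and>
    (\<forall>k\<ge>1. card (pverts (Gs k)) < card (pverts (Gs (k + 1)))) \<and>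
    pairwise (\<lambda>i j. orbitally_similar (Gs i) (Gs j)) {1..} \<and>
    digraph_iso (with_proj (Gs 1)) (with_proj G)"

end

theory Submission
  imports Defs
begin

text \<open>
  Let the orbits of \<open>G\<close> and \<open>H\<close> have sizes \<open>n\<^sub>i\<close> and \<open>m\<^sub>i\<close>, and let \<open>S = [s\<^sub>i\<^sub>j]\<close> be the common
  divisor matrix.  Counting the edges between two orbits from both sides gives
  \<open>n\<^sub>i s\<^sub>i\<^sub>j = n\<^sub>j s\<^sub>j\<^sub>i\<close> and \<open>m\<^sub>i s\<^sub>i\<^sub>j = m\<^sub>j s\<^sub>j\<^sub>i\<close>, so the ratio \<open>m\<^sub>i / n\<^sub>i\<close> is the same for adjacent
  orbits and hence, by connectedness, for all of them.  Vertices and edges are therefore scaled by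
  the same factor, and so is their difference: \<open>(c(H) - 1) / |H| = (c(G) - 1) / |G|\<close>.  All parts of
  the theorem follow, since \<open>c \<ge> 0\<close> for connected graphs.
\<close>

section \<open>Connected graphs\<close>

text \<open>The arc set is symmetric, so connectedness already yields directed walks. The closure
  form allows induction along a walk.\<close>

lemma connected_graph_rtrancl:
  assumes "connected_graph G" "u \<in> pverts G" "v \<in> pverts G"
  shows "(u, v) \<in> (parcs G)\<^sup>*"
proof -
  interpret pair_graph G using assms(1) by (simp add: connected_graph_def)
  have "strongly_connected (with_proj G)"
    using assms(1) sym_arcs
    by (auto simp: connected_graph_def intro: symmetric_connected_imp_strongly_connected)
  then have "(u, v) \<in> rtrancl_on (pverts G) (parcs G)"
    using assms(2,3) by (auto simp: strongly_connected_def reachable_def)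
  then show ?thesis by (rule rtrancl_on_rtranclI)
qed

text \<open>The fibre over an edge consists of its two orientations, which differ since there are no
  loops.\<close>

lemma (in pair_graph) card_parcs: "card (parcs G) = 2 * card (edges G)"
proof -
  let ?f = "\<lambda>(u, v). {u, v}"
  have two: "card {a \<in> parcs G. ?f a = e} = 2" if "e \<in> edges G" for e
  proof -
    obtain u v where uv: "(u, v) \<in> parcs G" "e = {u, v}" using \<open>e \<in> edges G\<close> by (auto simp: edges_def)
    then have "(v, u) \<in> parcs G" "u \<noteq> v"
      using arcs_symmetric pair_no_loops[of "(u, v)"] by auto
    with uv have "{a \<in> parcs G. ?f a = e} = {(u, v), (v, u)}" by (auto simp: doubleton_eq_iff)
    with \<open>u \<noteq> v\<close> show ?thesis by simp
  qed
  have "card (parcs G) = (\<Sum>e\<in>?f ` parcs G. card {a \<in> parcs G. ?f a = e})"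
    using sum.image_gen[OF pair_finite_arcs, of "\<lambda>_. 1 :: nat" ?f] by simp
  also have "\<dots> = (\<Sum>e\<in>edges G. 2)" using two by (simp add: edges_def)
  finally show ?thesis by simp
qed

text \<open>A breadth-first tree: each vertex other than a root \<open>r\<close> is charged with the
  edge to a parent closer to \<open>r\<close>, and no edge is charged twice.\<close>

lemma connected_graph_cyclomatic_number_nonneg:
  assumes "connected_graph G"
  shows "cyclomatic_number G \<ge> 0"
proof -
  interpret pair_graph G using assms by (simp add: connected_graph_def)
  have "pverts G \<noteq> {}"
    using assms by (auto simp: connected_graph_def connected_conv)
  then obtain r where r: "r \<in> pverts G" by blast
  \<comment> \<open>\<open>d v\<close> is the distance from \<open>r\<close> to \<open>v\<close>;
    \<open>p\<close> will send \<open>v\<close> to its predecessor on a shortest walk.\<close>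
  define d where "d v = (LEAST n. (r, v) \<in> parcs G ^^ n)" for v
  have walk: "(r, v) \<in> parcs G ^^ d v" if "v \<in> pverts G" for v
    using rtrancl_imp_relpow[OF connected_graph_rtrancl[OF assms r that]]
    unfolding d_def by (auto intro: LeastI)
  have least: "d v \<le> n" if "(r, v) \<in> parcs G ^^ n" for v n
    using that unfolding d_def by (rule Least_le)
  have "\<exists>p. (p, v) \<in> parcs G \<and> d p < d v" if v: "v \<in> pverts G - {r}" for v
  proof -
    have "d v \<noteq> 0" using walk[of v] v by (intro notI) auto
    then obtain n where n: "d v = Suc n" using not0_implies_Suc by blast
    then obtain p where "(r, p) \<in> parcs G ^^ n" "(p, v) \<in> parcs G"
      using walk[of v] v by auto
    with least[of p n] n show ?thesis by auto
  qed
  then obtain p where p: "\<And>v. v \<in> pverts G - {r} \<Longrightarrow> (p v, v) \<in> parcs G \<and> d (p v) < d v"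
    by metis
  have "inj_on (\<lambda>v. {p v, v}) (pverts G - {r})"
  proof (rule inj_onI)
    fix v w assume "v \<in> pverts G - {r}" "w \<in> pverts G - {r}" "{p v, v} = {p w, w}"
    \<comment> \<open>If \<open>v\<close> and \<open>w\<close> differed, each would be the parent of
      the other, giving both \<open>d w < d v\<close> and \<open>d v < d w\<close>.\<close>
    with p[of v] p[of w] show "v = w" by (auto simp: doubleton_eq_iff)
  qed
  moreover have "(\<lambda>v. {p v, v}) ` (pverts G - {r}) \<subseteq> edges G"
    unfolding edges_def using p by force
  moreover have "finite (edges G)" by (simp add: edges_def pair_finite_arcs)
  ultimately have "card (pverts G - {r}) \<le> card (edges G)" by (metis card_inj_on_le)
  then show ?thesis using r pair_finite_verts by (simp add: cyclomatic_number_def)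
qed

text \<open>An isomorphism is injective on vertices and on arcs; the edge counts then agree by
  halving.\<close>

lemma digraph_iso_cyclomatic_number:
  assumes "pair_graph G" "pair_graph H" "digraph_iso (with_proj G) (with_proj H)"
  shows "cyclomatic_number G = cyclomatic_number H"
proof -
  interpret G: pair_graph G by fact
  interpret H: pair_graph H by fact
  obtain f where f: "pre_digraph.digraph_isomorphism (with_proj G) f"
      "with_proj H = app_iso f (with_proj G)"
    using assms(3) by (auto simp: digraph_iso_def)
  have "pverts H = iso_verts f ` pverts G" "parcs H = iso_arcs f ` parcs G"
    using arg_cong[OF f(2), of verts] arg_cong[OF f(2), of arcs]
    by (simp_all add: verts_app_iso arcs_app_iso)
  moreover have "inj_on (iso_verts f) (pverts G)" "inj_on (iso_arcs f) (parcs G)"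
    using f(1) by (auto simp: pre_digraph.digraph_isomorphism_def)
  ultimately have "card (pverts H) = card (pverts G)" "card (parcs H) = card (parcs G)"
    by (simp_all add: card_image)
  then show ?thesis using G.card_parcs H.card_parcs by (simp add: cyclomatic_number_def)
qed

section \<open>Counting along orbits\<close>

context pair_graph
begin

context
  fixes Os
  assumes ord: "orbit_ordering G Os"
begin

lemma orbit_ordering_nonempty: "i < length Os \<Longrightarrow> Os ! i \<noteq> {}"
  using ord in_quotient_imp_non_empty[OF equiv_aut_similar] nth_mem
  by (fastforce simp: orbit_ordering_def orbits_def)

lemma orbit_ordering_disjoint:
  assumes "i < length Os" "j < length Os" "i \<noteq> j"
  shows "Os ! i \<inter> Os ! j = {}"
proof -
  have "Os ! i \<in> pverts G // aut_similar G" "Os ! j \<in> pverts G // aut_similar G"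
    using ord assms nth_mem by (auto simp: orbit_ordering_def orbits_def)
  moreover have "Os ! i \<noteq> Os ! j"
    using ord assms by (simp add: orbit_ordering_def nth_eq_iff_index_eq)
  ultimately show ?thesis using quotient_disj[OF equiv_aut_similar] by blast
qed

lemma orbit_ordering_Union: "(\<Union>i<length Os. Os ! i) = pverts G"
proof -
  have "(\<Union>i<length Os. Os ! i) = \<Union> (set Os)"
    by (simp add: set_conv_nth image_def setcompr_eq_image lessThan_def)
  also have "\<dots> = pverts G"
    using ord Union_quotient[OF equiv_aut_similar] by (simp add: orbit_ordering_def orbits_def)
  finally show ?thesis .
qed

lemma finite_orbit: "i < length Os \<Longrightarrow> finite (Os ! i)"
  using orbit_ordering_Union by (intro finite_subset[OF _ pair_finite_verts]) blast

lemma card_pverts_orbits: "card (pverts G) = (\<Sum>i<length Os. card (Os ! i))"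
  unfolding orbit_ordering_Union[symmetric]
  using finite_orbit orbit_ordering_disjoint by (intro card_UN_disjoint) auto

lemma card_arcs_between_orbits:
  assumes "i < length Os" "j < length Os"
  shows "card (parcs G \<inter> Os ! i \<times> Os ! j) = card (Os ! i) * orbit_divisor_matrix G Os $$ (i, j)"
proof -
  have "parcs G \<inter> Os ! i \<times> Os ! j = (SIGMA u:Os ! i. {v \<in> Os ! j. (u, v) \<in> parcs G})" by auto
  also have "card \<dots> = (\<Sum>u\<in>Os ! i. card {v \<in> Os ! j. (u, v) \<in> parcs G})"
    using assms finite_orbit by (intro card_SigmaI) auto
  also have "\<dots> = (\<Sum>u\<in>Os ! i. orbit_divisor_matrix G Os $$ (i, j))"
    using assms ord by (intro sum.cong) (auto simp: orbit_divisor_matrix_entry)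
  finally show ?thesis by simp
qed

text \<open>Double counting: reversing arcs is a bijection between the arcs from one orbit to the
  other and those going back.\<close>

lemma orbit_divisor_matrix_balance:
  assumes "i < length Os" "j < length Os"
  shows "card (Os ! i) * orbit_divisor_matrix G Os $$ (i, j)
       = card (Os ! j) * orbit_divisor_matrix G Os $$ (j, i)"
proof -
  have "prod.swap ` (parcs G \<inter> Os ! i \<times> Os ! j) = parcs G \<inter> Os ! j \<times> Os ! i"
    using arcs_symmetric by force
  then have "card (parcs G \<inter> Os ! i \<times> Os ! j) = card (parcs G \<inter> Os ! j \<times> Os ! i)"
    by (metis card_image inj_swap)
  with assms show ?thesis by (simp add: card_arcs_between_orbits)
qed

text \<open>Supplies the nonzero factor that is cancelled in
  \<open>orbit_sizes_proportional\<close>.\<close>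

lemma orbit_divisor_matrix_pos:
  assumes "i < length Os" "j < length Os" "u \<in> Os ! i" "v \<in> Os ! j" "(u, v) \<in> parcs G"
  shows "orbit_divisor_matrix G Os $$ (i, j) > 0"
  using assms ord finite_orbit by (auto simp: orbit_divisor_matrix_entry card_gt_0_iff)

text \<open>The blocks indexed by ordered pairs of orbits, diagonal ones included, partition the
  arcs. For a fixed matrix the arc count is thus linear in the orbit sizes.\<close>

lemma card_parcs_orbits:
  "card (parcs G) =
    (\<Sum>i<length Os. \<Sum>j<length Os. card (Os ! i) * orbit_divisor_matrix G Os $$ (i, j))"
proof -
  let ?I = "{..<length Os} \<times> {..<length Os}"
  let ?E = "\<lambda>(i, j). parcs G \<inter> Os ! i \<times> Os ! j"
  have "parcs G = (\<Union>p\<in>?I. ?E p)"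
  proof (intro equalityI subsetI)
    fix a assume a: "a \<in> parcs G"
    then have "fst a \<in> (\<Union>i<length Os. Os ! i)" "snd a \<in> (\<Union>i<length Os. Os ! i)"
      unfolding orbit_ordering_Union by (simp_all add: arc_fst_in_verts arc_snd_in_verts)
    then obtain i j where "i < length Os" "j < length Os" "fst a \<in> Os ! i" "snd a \<in> Os ! j" by blast
    with a show "a \<in> (\<Union>p\<in>?I. ?E p)" by (intro UN_I[of "(i, j)"]) (auto simp: mem_Times_iff)
  qed auto
  also have "card \<dots> = (\<Sum>p\<in>?I. card (?E p))"
    using orbit_ordering_disjoint pair_finite_arcs by (intro card_UN_disjoint) fastforce+
  also have "\<dots> = (\<Sum>(i, j)\<in>?I. card (Os ! i) * orbit_divisor_matrix G Os $$ (i, j))"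
    by (intro sum.cong) (auto simp: card_arcs_between_orbits)
  finally show ?thesis by (simp add: sum.cartesian_product)
qed

end

end

section \<open>Orbitally similar graphs\<close>

text \<open>Equality of the ratios \<open>card (Ps ! i) / card (Os ! i)\<close>, cross-multiplied to
  stay in the naturals. It propagates along a walk in \<open>G\<close>; \<open>H\<close> enters
  through its balance equations for the same matrix.\<close>

lemma orbit_sizes_proportional:
  assumes "connected_graph G" "connected_graph H"
    and Os: "orbit_ordering G Os" and Ps: "orbit_ordering H Ps"
    and eq: "orbit_divisor_matrix G Os = orbit_divisor_matrix H Ps"
    and ij: "i < length Os" "j < length Os"
  shows "card (Ps ! i) * card (Os ! j) = card (Ps ! j) * card (Os ! i)"
proof -
  interpret G: pair_graph G using assms(1) by (simp add: connected_graph_def)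
  interpret H: pair_graph H using assms(2) by (simp add: connected_graph_def)
  define s where "s i j = orbit_divisor_matrix G Os $$ (i, j)" for i j
  have len: "length Ps = length Os"
    using arg_cong[OF eq, of dim_row] by (simp add: orbit_divisor_matrix_def)
  obtain u v where uv: "u \<in> Os ! i" "v \<in> Os ! j"
    using ij G.orbit_ordering_nonempty[OF Os] by blast
  then have "u \<in> pverts G" "v \<in> pverts G"
    using ij G.orbit_ordering_Union[OF Os] by auto
  then have "(u, v) \<in> (parcs G)\<^sup>*" using assms(1) by (intro connected_graph_rtrancl)
  then show ?thesis using ij(2) uv(2)
  \<comment> \<open>\<open>j\<close> is generalised because it indexes the orbit of the current
    endpoint of the walk, which changes at each step.\<close>
  proof (induction arbitrary: j rule: rtrancl_induct)
    case base
    then have "i = j" using G.orbit_ordering_disjoint[OF Os ij(1), of j] uv(1) by blast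
    then show ?case by simp
  next
    case (step y z)
    have "y \<in> pverts G" using step.hyps(2) by (rule G.in_arcsD1)
    then obtain k where k: "k < length Os" "y \<in> Os ! k" using G.orbit_ordering_Union[OF Os] by blast
    have IH: "card (Ps ! i) * card (Os ! k) = card (Ps ! k) * card (Os ! i)"
      using step.IH k by blast
    \<comment> \<open>The reversed arc is the one that makes \<open>s j k\<close> positive, the
      factor left at the end of the calculation below.\<close>
    have "(z, y) \<in> parcs G" using step.hyps(2) G.arcs_symmetric by blast
    then have pos: "s j k > 0"
      unfolding s_def using G.orbit_divisor_matrix_pos[OF Os] step.prems k by blast
    have n: "card (Os ! k) * s k j = card (Os ! j) * s j k"
      unfolding s_def using G.orbit_divisor_matrix_balance[OF Os] step.prems k by blast
    have m: "card (Ps ! k) * s k j = card (Ps ! j) * s j k"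
      unfolding s_def eq using H.orbit_divisor_matrix_balance[OF Ps] step.prems k len by simp
    have "card (Ps ! i) * card (Os ! j) * s j k = card (Ps ! i) * card (Os ! k) * s k j"
      using n by simp
    also have "\<dots> = card (Ps ! j) * card (Os ! i) * s j k"
      using IH m by (metis mult.assoc mult.commute)
    finally show ?case using pos by simp
  qed
qed

text \<open>Both counts are linear in the orbit sizes with the same coefficients, so both scale by
  the common ratio.\<close>

lemma orbitally_similar_card:
  assumes "orbitally_similar G H"
  shows "card (pverts G) * card (parcs H) = card (pverts H) * card (parcs G)"
proof -
  obtain Os Ps where conn: "connected_graph G" "connected_graph H"
    and Os: "orbit_ordering G Os" and Ps: "orbit_ordering H Ps"
    and eq: "orbit_divisor_matrix G Os = orbit_divisor_matrix H Ps"
    using assms by (auto simp: orbitally_similar_def)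
  interpret G: pair_graph G using conn(1) by (simp add: connected_graph_def)
  interpret H: pair_graph H using conn(2) by (simp add: connected_graph_def)
  let ?s = "\<lambda>i j. orbit_divisor_matrix G Os $$ (i, j)"
  have len: "length Ps = length Os"
    using arg_cong[OF eq, of dim_row] by (simp add: orbit_divisor_matrix_def)
  \<comment> \<open>Summing the proportionality over the second orbit identifies the common ratio as
    that of the orders.\<close>
  have scale: "card (pverts G) * card (Ps ! i) = card (pverts H) * card (Os ! i)"
    if "i < length Os" for i
    unfolding G.card_pverts_orbits[OF Os] H.card_pverts_orbits[OF Ps] len sum_distrib_right
    using orbit_sizes_proportional[OF conn Os Ps eq that]
    by (intro sum.cong) (simp_all add: mult.commute)
  have "card (pverts G) * card (parcs H)
      = (\<Sum>i<length Os. \<Sum>j<length Os. card (pverts G) * card (Ps ! i) * ?s i j)"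
    using H.card_parcs_orbits[OF Ps] by (simp add: eq len sum_distrib_left mult.assoc)
  also have "\<dots> = (\<Sum>i<length Os. \<Sum>j<length Os. card (pverts H) * card (Os ! i) * ?s i j)"
    using scale by (intro sum.cong) simp_all
  also have "\<dots> = card (pverts H) * card (parcs G)"
    using G.card_parcs_orbits[OF Os] by (simp add: sum_distrib_left mult.assoc)
  finally show ?thesis .
qed

text \<open>\<open>cyclomatic_number\<close> minus 1 is edges minus vertices, and both terms scale
  with the order. Integers are used since the difference is -1 for a tree.\<close>

lemma orbitally_similar_cyclomatic_number:
  assumes "orbitally_similar G H"
  shows "int (card (pverts G)) * (cyclomatic_number H - 1)
       = int (card (pverts H)) * (cyclomatic_number G - 1)"
proof -
  have "card (parcs G) = 2 * card (edges G)" "card (parcs H) = 2 * card (edges H)"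
    using assms by (auto simp: orbitally_similar_def connected_graph_def pair_graph.card_parcs)
  with orbitally_similar_card[OF assms]
  have "card (pverts G) * card (edges H) = card (pverts H) * card (edges G)" by simp
  then have "int (card (pverts G)) * int (card (edges H)) = int (card (pverts H)) * int (card (edges G))"
    by (metis of_nat_mult)
  then show ?thesis by (simp add: cyclomatic_number_def algebra_simps)
qed

text \<open>Here \<open>cyclomatic_number G - 1\<close> is positive, so scaling it by a factor above
  1 strictly increases it.\<close>

lemma orbitally_similar_cyclomatic_number_less:
  assumes "orbitally_similar G H" "card (pverts G) < card (pverts H)" "cyclomatic_number G \<ge> 2"
  shows "cyclomatic_number G < cyclomatic_number H"
proof (rule ccontr)
  let ?n = "int (card (pverts G))"
  assume "\<not> cyclomatic_number G < cyclomatic_number H"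
  then have "?n * (cyclomatic_number H - 1) \<le> ?n * (cyclomatic_number G - 1)"
    by (intro mult_left_mono) auto
  also have "\<dots> < int (card (pverts H)) * (cyclomatic_number G - 1)"
    using assms(2,3) by (intro mult_strict_right_mono) auto
  finally show False using orbitally_similar_cyclomatic_number[OF assms(1)] by simp
qed

text \<open>Over the integers every strict increase is by at least 1, so growth from index
  \<open>m\<close> on is at least linear.\<close>

lemma strict_mono_on_atLeast_filterlim_at_top:
  fixes f :: "nat \<Rightarrow> int"
  assumes "strict_mono_on {m..} f"
  shows "filterlim f at_top sequentially"
proof -
  have growth: "int k + f m \<le> f (k + m)" for k
  proof (induction k)
    case (Suc k)
    have "f (k + m) < f (Suc k + m)" using assms by (rule strict_mono_onD) auto
    with Suc show ?case by simp
  qed simp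
  show ?thesis
    unfolding filterlim_at_top eventually_sequentially
  proof (intro allI exI impI)
    \<comment> \<open>The summand \<open>m\<close> ensures \<open>m \<le> k\<close>, so that
      \<open>k - m\<close> is not truncated; \<open>nat\<close> covers the case
      \<open>Z < f m\<close>.\<close>
    fix Z k assume "nat (Z - f m) + m \<le> k"
    then show "Z \<le> f k" using growth[of "k - m"] by simp
  qed
qed

section \<open>Self-similar sequences\<close>

lemma self_similar_sequence_connected:
  "self_similar_sequence G Gs \<Longrightarrow> k \<ge> 1 \<Longrightarrow> connected_graph (Gs k)"
  by (simp add: self_similar_sequence_def)

lemma self_similar_sequence_similar:
  "self_similar_sequence G Gs \<Longrightarrow> 1 \<le> i \<Longrightarrow> i < j \<Longrightarrow> orbitally_similar (Gs i) (Gs j)"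
  by (auto simp: self_similar_sequence_def pairwise_def)

lemma self_similar_sequence_cyclomatic_number_first:
  assumes "connected_graph G" "self_similar_sequence G Gs"
  shows "cyclomatic_number (Gs 1) = cyclomatic_number G"
  using assms
  by (intro digraph_iso_cyclomatic_number)
    (simp_all add: self_similar_sequence_def connected_graph_def)

lemma self_similar_sequence_card_less:
  assumes "self_similar_sequence G Gs" "1 \<le> i" "i < j"
  shows "card (pverts (Gs i)) < card (pverts (Gs j))"
proof -
  have inc: "card (pverts (Gs k)) < card (pverts (Gs (Suc k)))" if "k \<ge> 1" for k
    using assms(1) that by (simp add: self_similar_sequence_def)
  \<comment> \<open>Starting the induction at \<open>Suc i\<close> makes its base case a single step
    of the sequence.\<close>
  have "Suc i \<le> j" using assms(3) by simp
  then show ?thesis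
  proof (induction j rule: dec_induct)
    case base show ?case using inc assms(2) .
  next
    case (step k)
    then show ?case using assms(2) inc[of k] by linarith
  qed
qed

theorem theorem5:
  fixes G :: "'a pair_pre_digraph"
  assumes "connected_graph G"
  shows "(tree_graph G \<longrightarrow> \<not> (\<exists>Gs :: nat \<Rightarrow> 'b pair_pre_digraph. self_similar_sequence G Gs)) \<and>
    (\<forall>Gs :: nat \<Rightarrow> 'b pair_pre_digraph.
       unicyclic G \<and> self_similar_sequence G Gs \<longrightarrow> (\<forall>k\<ge>1. unicyclic (Gs k))) \<and>
    (\<forall>Gs :: nat \<Rightarrow> 'b pair_pre_digraph.
       cyclomatic_number G \<ge> 2 \<and> self_similar_sequence G Gs \<longrightarrow>
         strict_mono_on {1..} (\<lambda>k. cyclomatic_number (Gs k)) \<and>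
         filterlim (\<lambda>k. cyclomatic_number (Gs k)) at_top sequentially)"
proof (intro conjI impI allI)
  note conn = self_similar_sequence_connected and sim = self_similar_sequence_similar
    and first = self_similar_sequence_cyclomatic_number_first[OF assms]
    and less = self_similar_sequence_card_less
  {
    assume "tree_graph G"
    show "\<not> (\<exists>Gs :: nat \<Rightarrow> 'b pair_pre_digraph. self_similar_sequence G Gs)"
    proof
      assume "\<exists>Gs :: nat \<Rightarrow> 'b pair_pre_digraph. self_similar_sequence G Gs"
      then obtain Gs :: "nat \<Rightarrow> 'b pair_pre_digraph" where Gs: "self_similar_sequence G Gs" ..
      let ?n = "int (card (pverts (Gs 1)))" and ?m = "int (card (pverts (Gs 2)))"
      \<comment> \<open>The first term has cyclomatic number 0. Nonnegativity for the second then
        forces \<open>?m \<le> ?n\<close>, although the orders increase.\<close>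
      have "?n * (cyclomatic_number (Gs 2) - 1) = - ?m"
        using orbitally_similar_cyclomatic_number[OF sim[OF Gs, of 1 2]] first[OF Gs]
          \<open>tree_graph G\<close> by (simp add: tree_graph_def)
      moreover have "?n * - 1 \<le> ?n * (cyclomatic_number (Gs 2) - 1)"
        using connected_graph_cyclomatic_number_nonneg[OF conn[OF Gs, of 2]]
        by (intro mult_left_mono) simp_all
      moreover have "?n < ?m" using less[OF Gs, of 1 2] by simp
      ultimately show False by simp
    qed
  next
    fix Gs :: "nat \<Rightarrow> 'b pair_pre_digraph" and k :: nat
    assume G: "unicyclic G \<and> self_similar_sequence G Gs" and k: "1 \<le> k"
    then have Gs: "self_similar_sequence G Gs" by simp
    have one: "cyclomatic_number (Gs 1) = 1" using first[OF Gs] G by (simp add: unicyclic_def)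
    have "cyclomatic_number (Gs k) = 1"
    \<comment> \<open>Similarity is available for distinct indices only, so the first term is
      treated apart.\<close>
    proof (cases "k = 1")
      case False
      with k have "1 < k" by simp
      \<comment> \<open>The order of \<open>Gs 1\<close> must be nonzero to be cancelled from a
        product equal to 0.\<close>
      have "pverts (Gs 1) \<noteq> {}" "finite (pverts (Gs 1))"
        using conn[OF Gs, of 1] pair_fin_digraph.pair_finite_verts
        by (auto simp: connected_graph_def connected_conv pair_graph_def pair_digraph_def)
      then show ?thesis
        using orbitally_similar_cyclomatic_number[OF sim[OF Gs _ \<open>1 < k\<close>]] one by simp
    next
      case True
      with one show ?thesis by (simp only:)
    qed
    then show "unicyclic (Gs k)" using conn[OF Gs k] by (simp add: unicyclic_def)
  next
    fix Gs :: "nat \<Rightarrow> 'b pair_pre_digraph"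
    assume G: "2 \<le> cyclomatic_number G \<and> self_similar_sequence G Gs"
    then have Gs: "self_similar_sequence G Gs" by simp
    \<comment> \<open>Comparing every term directly with the first carries the bound 2 to the whole
      sequence, after which any two terms can be compared.\<close>
    have first_less: "cyclomatic_number (Gs 1) < cyclomatic_number (Gs k)" if "1 < k" for k
      using orbitally_similar_cyclomatic_number_less[OF sim[OF Gs _ that] less[OF Gs _ that]]
        first[OF Gs] G by simp
    show "strict_mono_on {1..} (\<lambda>k. cyclomatic_number (Gs k))"
    proof (rule strict_mono_onI)
      fix i j :: nat assume "i \<in> {1..}" "j \<in> {1..}" "i < j"
      then have i: "1 \<le> i" "i < j" by simp_all
      have "cyclomatic_number (Gs i) \<ge> 2"
        using first_less[of i] first[OF Gs] G i(1) by (cases "i = 1") auto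
      then show "cyclomatic_number (Gs i) < cyclomatic_number (Gs j)"
        using orbitally_similar_cyclomatic_number_less[OF sim[OF Gs i] less[OF Gs i]] by simp
    qed
    then show "filterlim (\<lambda>k. cyclomatic_number (Gs k)) at_top sequentially"
      by (rule strict_mono_on_atLeast_filterlim_at_top)
  }
qed

end
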